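(* Let $X$ be a graph on $n$ vertices with adjacency matrix $A$, and let $A=\sum_{r=1}^m \theta_r E_r$ be the spectral decomposition of $A$ (the $\theta_r$ distinct eigenvalues, $E_r$ the orthogonal projection onto the $\theta_r$-eigenspace). The following are equivalent: (a) $X$ is 1-walk regular. (b) For every positive integer $k$ there exist scalars $a_k,b_k$ such that $A^k\circ I=a_kI$ and $A^k\circ A=b_kA$. (c) For every integer $k=1,\ldots,n-1$ there exist scalars $a_k,b_k$ such that $A^k\circ I=a_kI$ and $A^k\circ A=b_kA$. (d) For $r=1,\ldots,m$ there exist scalars $\alpha_r,\beta_r$ such that $E_r\circ I=\alpha_rI$ and $E_r\circ A=\beta_rA$. (e) There exist functions $a(t),b(t)$ such that $(tI-A)^{-1}\circ I=a(t)I$ and $(tI-A)^{-1}\circ A=b(t)A$. (f) There exist polynomials $f(t),g(t)$ such that $\operatorname{adj}(tI-A)\circ I=f(t)I$ and $\operatorname{adj}(tI-A)\circ A=g(t)A$. (g) $\phi(X\backslash u,t)$ is the same for all $u\in V(X)$, and $\phi(X\backslash\{u,v\},t)$ is the same for all pairs of adjacent vertices $u,v$ of $X$.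
   Context: A graph is walk-regular if for every positive integer $k$ the number of closed walks of length $k$ starting at a vertex is the same for all vertices; it is 1-walk regular if it is walk-regular and, for every positive integer $k$, the number of walks of length $k$ from $u$ to $v$ is the same for all pairs of adjacent vertices $u,v$. $M\circ N$ denotes the Schur (entrywise) product. $\operatorname{adj}(M)$ is the adjugate of $M$. $\phi(Y,t)=\det(tI-A(Y))$ is the characteristic polynomial of the adjacency matrix of $Y$, and for $R\subseteq V(X)$, $X\backslash R$ is the graph obtained by deleting the vertices in $R$ ($X\backslash u$ when $R=\{u\}$). *)

theory Defs
  imports
    "Graph_Theory.Arc_Walk"
    "Graph_Theory.Digraph_Component"
    "Jordan_Normal_Form.Char_Poly"
    "Jordan_Normal_Form.Gauss_Jordan_Elimination"
begin

text \<open>A simple graph is a structure satisfying the locale predicate \<open>graph\<close>: a finite symmetric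
  digraph without loops and without parallel arcs, so each edge is a pair of opposite arcs.
  Under this predicate the arc sequences counted below are in bijection with vertex sequences.\<close>

definition num_walks :: "('a, 'b) pre_digraph \<Rightarrow> nat \<Rightarrow> 'a \<Rightarrow> 'a \<Rightarrow> nat" where
  "num_walks X k u v = card {p. pre_digraph.awalk X u p v \<and> length p = k}"

definition walk_regular :: "('a, 'b) pre_digraph \<Rightarrow> bool" where
  "walk_regular X \<longleftrightarrow>
     (\<forall>k\<ge>1. \<forall>u\<in>verts X. \<forall>v\<in>verts X. num_walks X k u u = num_walks X k v v)"

definition one_walk_regular :: "('a, 'b) pre_digraph \<Rightarrow> bool" where
  "one_walk_regular X \<longleftrightarrow> walk_regular X \<and>
     (\<forall>k\<ge>1. \<forall>u v x y. u \<rightarrow>\<^bsub>X\<^esub> v \<longrightarrow> x \<rightarrow>\<^bsub>X\<^esub> y \<longrightarrow> num_walks X k u v = num_walks X k x y)"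

text \<open>Rows and columns are indexed by the positions in an arbitrary fixed listing of the vertices;
  another listing conjugates the matrix by a permutation matrix.\<close>

definition vertex_list :: "('a, 'b) pre_digraph \<Rightarrow> 'a list" where
  "vertex_list X = (SOME vs. distinct vs \<and> set vs = verts X)"

definition adjacency_matrix :: "('a, 'b) pre_digraph \<Rightarrow> real mat" where
  "adjacency_matrix X = mat (card (verts X)) (card (verts X))
     (\<lambda>(i, j). if vertex_list X ! i \<rightarrow>\<^bsub>X\<^esub> vertex_list X ! j then 1 else 0)"

definition graph_char_poly :: "('a, 'b) pre_digraph \<Rightarrow> real poly" where
  "graph_char_poly X = char_poly (adjacency_matrix X)"

definition delete_verts :: "('a, 'b) pre_digraph \<Rightarrow> 'a set \<Rightarrow> ('a, 'b) pre_digraph" where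
  "delete_verts X R = X \<restriction> (verts X - R)"

definition schur_prod :: "'a::times mat \<Rightarrow> 'a mat \<Rightarrow> 'a mat" (infixl \<open>\<circ>\<^sub>m\<close> 70) where
  "M \<circ>\<^sub>m N = mat (dim_row M) (dim_col M) (\<lambda>(i, j). M $$ (i, j) * N $$ (i, j))"

definition eigenspace :: "real mat \<Rightarrow> real \<Rightarrow> real vec set" where
  "eigenspace A \<theta> = {v \<in> carrier_vec (dim_row A). A *\<^sub>v v = \<theta> \<cdot>\<^sub>v v}"

definition orthogonal_projection :: "nat \<Rightarrow> real vec set \<Rightarrow> real mat \<Rightarrow> bool" where
  "orthogonal_projection n S P \<longleftrightarrow> P \<in> carrier_mat n n \<and>
     (\<forall>v\<in>carrier_vec n. P *\<^sub>v v \<in> S \<and> (\<forall>w\<in>S. (v - P *\<^sub>v v) \<bullet> w = 0))"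

definition spectral_decomposition ::
    "real mat \<Rightarrow> nat \<Rightarrow> (nat \<Rightarrow> real) \<Rightarrow> (nat \<Rightarrow> real mat) \<Rightarrow> bool" where
  "spectral_decomposition A m \<theta> E \<longleftrightarrow>
     inj_on \<theta> {1..m} \<and>
     \<theta> ` {1..m} = {x. eigenvalue A x} \<and>
     (\<forall>r\<in>{1..m}. orthogonal_projection (dim_row A) (eigenspace A (\<theta> r)) (E r)) \<and>
     A = mat (dim_row A) (dim_row A) (\<lambda>(i, j). \<Sum>r=1..m. \<theta> r * E r $$ (i, j))"

end

theory Submission
  imports Defs
begin

text \<open>
  Every matrix occurring in the conditions is a linear combination of the idempotents \<open>E r\<close>:
  \<open>A ^ k = \<Sum>r. \<theta> r ^ k E r\<close> and \<open>(t I - A)\<^sup>-\<^sup>1 = \<Sum>r. (1 / (t - \<theta> r)) E r\<close>. Conversely the \<open>E r\<close> are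
  recovered from the powers below \<open>m \<le> n\<close> by inverting a Vandermonde system, and from the resolvent
  by clearing denominators and evaluating at \<open>\<theta> r\<close>. So two entries agree in all \<open>E r\<close> iff they agree
  in all these powers, iff they agree in the resolvent, iff they agree in the adjugate.

  For the vertex-deleted subgraphs, Jacobi's identity says that a principal minor of the
  resolvent times \<open>\<phi>(X,t)\<close> is the complementary minor of \<open>t I - A\<close>; with one or two vertices this
  gives the diagonal entries and, given those, the squares of the entries at edges. The remaining
  sign does not depend on \<open>t\<close>, and is positive since \<open>A = \<Sum>r. \<theta> r E r\<close> equals 1 at all edges.
\<close>

section \<open>Preliminaries on vectors, Vandermonde systems and polynomials\<close>

lemma scalar_prod_self_eq_0:
  fixes v :: "real vec"
  assumes "v \<bullet> v = 0" and v: "v \<in> carrier_vec n"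
  shows "v = 0\<^sub>v n"
proof (rule eq_vecI)
  have "\<forall>i\<in>{0..<n}. v $ i * v $ i = 0"
    using assms by (subst sum_nonneg_eq_0_iff[symmetric]) (auto simp: scalar_prod_def)
  then show "\<And>i. i < dim_vec (0\<^sub>v n) \<Longrightarrow> v $ i = 0\<^sub>v n $ i" by auto
qed (use v in auto)

lemma mat_eq_by_mult_vec:
  fixes M N :: "'a :: semiring_1 mat"
  assumes M: "M \<in> carrier_mat k n" and N: "N \<in> carrier_mat k n"
    and "\<And>v. v \<in> carrier_vec n \<Longrightarrow> M *\<^sub>v v = N *\<^sub>v v"
  shows "M = N"
proof (rule eq_matI)
  fix i j assume ij: "i < dim_row N" "j < dim_col N"
  have col: "(P *\<^sub>v unit_vec n j) $ i = P $$ (i, j)" if "P \<in> carrier_mat k n"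
    for P :: "'a mat" using that ij N by auto
  show "M $$ (i, j) = N $$ (i, j)"
    using col[OF M] col[OF N] assms(3)[of "unit_vec n j"] by simp
qed (use M N in auto)

text \<open>The Vandermonde system at distinct nodes is nonsingular: test against the polynomial
  vanishing at all nodes but one.\<close>

lemma vandermonde_trivial_kernel:
  fixes \<theta> e :: "'b \<Rightarrow> 'a :: idom"
  assumes fin: "finite R" and inj: "inj_on \<theta> R"
    and zero: "\<And>k. k < card R \<Longrightarrow> (\<Sum>s\<in>R. \<theta> s ^ k * e s) = 0"
    and r: "r \<in> R"
  shows "e r = 0"
proof -
  define q where "q = (\<Prod>s\<in>R - {r}. [:- \<theta> s, 1:])"
  have deg: "degree q < card R"
  proof -
    have "degree q \<le> (\<Sum>s\<in>R - {r}. degree [:- \<theta> s, 1:])"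
      unfolding q_def using fin degree_prod_sum_le[of "R - {r}" "\<lambda>s. [:- \<theta> s, 1:]"] by (simp add: o_def)
    also have "\<dots> = card R - 1" using r fin by simp
    finally show ?thesis using r fin card_gt_0_iff[of R] by fastforce
  qed
  have "(\<Sum>s\<in>R. poly q (\<theta> s) * e s) = (\<Sum>s\<in>R. \<Sum>k\<le>degree q. coeff q k * (\<theta> s ^ k * e s))"
    by (simp add: poly_altdef sum_distrib_right mult.assoc)
  also have "\<dots> = (\<Sum>k\<le>degree q. coeff q k * (\<Sum>s\<in>R. \<theta> s ^ k * e s))"
    by (subst sum.swap) (simp add: sum_distrib_left)
  also have "\<dots> = 0" using deg by (intro sum.neutral) (auto simp: zero)
  finally have "(\<Sum>s\<in>R. poly q (\<theta> s) * e s) = 0" .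
  moreover have "(\<Sum>s\<in>R. poly q (\<theta> s) * e s) = (\<Sum>s\<in>{r}. poly q (\<theta> s) * e s)"
    using r fin by (intro sum.mono_neutral_right) (auto simp: q_def poly_prod)
  moreover have "poly q (\<theta> r) \<noteq> 0"
    using inj r fin by (auto simp: q_def poly_prod inj_on_def)
  ultimately show ?thesis by simp
qed

text \<open>A nonzero difference has finitely many roots, but the complement of \<open>S\<close> is
  infinite in characteristic 0. This lifts identities known only off the spectrum to identities of
  polynomials.\<close>

lemma poly_eq_if_eq_off_finite:
  fixes p q :: "'a :: {idom, ring_char_0} poly"
  assumes "finite S" and "\<And>t. t \<notin> S \<Longrightarrow> poly p t = poly q t"
  shows "p = q"
proof (rule ccontr)
  assume "p \<noteq> q"
  then have "finite {t. poly (p - q) t = 0}" by (intro poly_roots_finite) simp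
  moreover have "UNIV - S \<subseteq> {t. poly (p - q) t = 0}" using assms(2) by auto
  ultimately have "finite (UNIV - S)" by (rule rev_finite_subset)
  then show False using assms(1) infinite_UNIV_char_0[where 'a='a] by simp
qed

section \<open>Spectral calculus of a symmetric real matrix\<close>

locale symmetric_spectral =
  fixes A :: "real mat" and n m :: nat and \<theta> :: "nat \<Rightarrow> real" and E :: "nat \<Rightarrow> real mat"
  assumes carrier: "A \<in> carrier_mat n n"
    and symmetric: "A\<^sup>T = A"
    and decomposition: "spectral_decomposition A m \<theta> E"
begin

text \<open>Functional calculus: this is f(A) for any function f with
  \<open>f (\<theta> r) = c r\<close>. Powers, shifts and resolvents are all treated in this
  form.\<close>

definition spectral_sum :: "(nat \<Rightarrow> real) \<Rightarrow> real mat" where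
  "spectral_sum c = mat n n (\<lambda>(i, j). \<Sum>r=1..m. c r * E r $$ (i, j))"

lemma spectral_sum_carrier [simp]: "spectral_sum c \<in> carrier_mat n n"
  by (simp add: spectral_sum_def)

lemma spectral_sum_dim [simp]: "dim_row (spectral_sum c) = n" "dim_col (spectral_sum c) = n"
  by (simp_all add: spectral_sum_def)

lemma spectral_sum_index:
  "i < n \<Longrightarrow> j < n \<Longrightarrow> spectral_sum c $$ (i, j) = (\<Sum>r=1..m. c r * E r $$ (i, j))"
  by (simp add: spectral_sum_def)

lemma inj_theta: "inj_on \<theta> {1..m}"
  using decomposition by (simp add: spectral_decomposition_def)

lemma theta_image: "\<theta> ` {1..m} = {x. eigenvalue A x}"
  using decomposition by (simp add: spectral_decomposition_def)

lemma spectral_sum_theta: "spectral_sum \<theta> = A"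
  using decomposition carrier by (simp add: spectral_decomposition_def spectral_sum_def)

lemma projection:
  assumes "r \<in> {1..m}"
  shows "orthogonal_projection n (eigenspace A (\<theta> r)) (E r)"
  using assms decomposition carrier_matD(1)[OF carrier] by (metis spectral_decomposition_def)

lemma projection_carrier: "r \<in> {1..m} \<Longrightarrow> E r \<in> carrier_mat n n"
  using projection by (auto simp: orthogonal_projection_def)

lemma projection_range:
  "r \<in> {1..m} \<Longrightarrow> v \<in> carrier_vec n \<Longrightarrow> E r *\<^sub>v v \<in> eigenspace A (\<theta> r)"
  using projection by (auto simp: orthogonal_projection_def)

lemma eigenspace_carrier: "v \<in> eigenspace A x \<Longrightarrow> v \<in> carrier_vec n"
  using carrier by (auto simp: eigenspace_def)

lemma projection_scalar_prod:
  assumes r: "r \<in> {1..m}" and v: "v \<in> carrier_vec n" and w: "w \<in> eigenspace A (\<theta> r)"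
  shows "(E r *\<^sub>v v) \<bullet> w = v \<bullet> w"
proof -
  have "(v - E r *\<^sub>v v) \<bullet> w = 0"
    using projection[OF r] v w by (auto simp: orthogonal_projection_def)
  moreover have "(v - E r *\<^sub>v v) \<bullet> w = v \<bullet> w - (E r *\<^sub>v v) \<bullet> w"
    using projection_carrier[OF r] v eigenspace_carrier[OF w]
    by (intro minus_scalar_prod_distrib) auto
  ultimately show ?thesis by simp
qed

text \<open>Moving \<open>A\<close> across the scalar product by symmetry multiplies
  \<open>v \<bullet> w\<close> by \<open>x\<close> on one side and by \<open>y\<close> on the
  other.\<close>

lemma eigenspaces_orthogonal:
  assumes v: "v \<in> eigenspace A x" and w: "w \<in> eigenspace A y" and "x \<noteq> y"
  shows "v \<bullet> w = 0"
proof -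
  note vw = eigenspace_carrier[OF v] eigenspace_carrier[OF w]
  have "(A *\<^sub>v v) \<bullet> w = v \<bullet> (A *\<^sub>v w)"
    using transpose_vec_mult_scalar[OF carrier vw(2,1)] symmetric vw carrier
    by (metis comm_scalar_prod mult_mat_vec_carrier)
  then have "x * (v \<bullet> w) = y * (v \<bullet> w)"
    using v w vw carrier by (auto simp: eigenspace_def)
  with \<open>x \<noteq> y\<close> show ?thesis by simp
qed

text \<open>The projection of \<open>v\<close> lies in the eigenspace, so its scalar product with
  itself equals its scalar product with \<open>v\<close>, which is 0.\<close>

lemma projection_orthogonal_vec:
  assumes r: "r \<in> {1..m}" and v: "v \<in> carrier_vec n"
    and orth: "\<And>w. w \<in> eigenspace A (\<theta> r) \<Longrightarrow> v \<bullet> w = 0"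
  shows "E r *\<^sub>v v = 0\<^sub>v n"
proof (rule scalar_prod_self_eq_0)
  have w: "E r *\<^sub>v v \<in> eigenspace A (\<theta> r)" by (rule projection_range[OF r v])
  show "(E r *\<^sub>v v) \<bullet> (E r *\<^sub>v v) = 0"
    using projection_scalar_prod[OF r v w] orth[OF w] by simp
  show "E r *\<^sub>v v \<in> carrier_vec n" using w by (rule eigenspace_carrier)
qed

text \<open>The defect \<open>v - E r *\<^sub>v v\<close> is orthogonal to the eigenspace and also
  lies in it as a difference of two members, so it is orthogonal to itself.\<close>

lemma projection_fixes:
  assumes r: "r \<in> {1..m}" and v: "v \<in> eigenspace A (\<theta> r)"
  shows "E r *\<^sub>v v = v"
proof -
  have vc: "v \<in> carrier_vec n" using v by (rule eigenspace_carrier)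
  have p: "E r *\<^sub>v v \<in> eigenspace A (\<theta> r)" by (rule projection_range[OF r vc])
  have pc: "E r *\<^sub>v v \<in> carrier_vec n" using p by (rule eigenspace_carrier)
  let ?d = "v - E r *\<^sub>v v"
  have "?d \<bullet> ?d = ?d \<bullet> v - ?d \<bullet> (E r *\<^sub>v v)"
    using vc pc by (intro scalar_prod_minus_distrib) auto
  also have "\<dots> = 0"
    using projection[OF r] v vc p by (auto simp: orthogonal_projection_def)
  finally have "?d = 0\<^sub>v n" using vc pc by (intro scalar_prod_self_eq_0) auto
  then have "\<And>i. i < n \<Longrightarrow> v $ i - (E r *\<^sub>v v) $ i = 0"
    using vc pc by (metis carrier_vecD index_minus_vec(1) index_zero_vec(1))
  then show ?thesis using vc projection_carrier[OF r] by (intro eq_vecI) auto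
qed

text \<open>Vectors in the range of \<open>E s\<close> are fixed by \<open>E s\<close> and, by
  orthogonality of eigenspaces, killed by every other projection.\<close>

lemma projection_mult:
  assumes r: "r \<in> {1..m}" and s: "s \<in> {1..m}"
  shows "E r * E s = (if r = s then E r else 0\<^sub>m n n)"
proof (rule mat_eq_by_mult_vec)
  note rc = projection_carrier[OF r] and sc = projection_carrier[OF s]
  show "E r * E s \<in> carrier_mat n n" using rc sc by auto
  show "(if r = s then E r else 0\<^sub>m n n) \<in> carrier_mat n n" using rc by auto
  fix v :: "real vec" assume v: "v \<in> carrier_vec n"
  have w: "E s *\<^sub>v v \<in> eigenspace A (\<theta> s)" by (rule projection_range[OF s v])
  have "E r *\<^sub>v (E s *\<^sub>v v) = (if r = s then E r else 0\<^sub>m n n) *\<^sub>v v"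
  proof (cases "r = s")
    case True
    then show ?thesis using projection_fixes[OF s w] by simp
  next
    case False
    then have "\<theta> s \<noteq> \<theta> r" using inj_theta r s by (metis inj_on_def)
    then have "E r *\<^sub>v (E s *\<^sub>v v) = 0\<^sub>v n"
      using eigenspaces_orthogonal[OF w] eigenspace_carrier[OF w]
      by (intro projection_orthogonal_vec[OF r]) auto
    then show ?thesis using False v by auto
  qed
  then show "E r * E s *\<^sub>v v = (if r = s then E r else 0\<^sub>m n n) *\<^sub>v v"
    using rc sc v by simp
qed

text \<open>Since the \<open>E r\<close> are mutually orthogonal idempotents, the double sum
  collapses to its diagonal.\<close>

lemma spectral_sum_mult: "spectral_sum c * spectral_sum d = spectral_sum (\<lambda>r. c r * d r)"
proof (rule eq_matI)
  fix i j assume "i < dim_row (spectral_sum (\<lambda>r. c r * d r))"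
    "j < dim_col (spectral_sum (\<lambda>r. c r * d r))"
  then have ij: "i < n" "j < n" by (auto simp: spectral_sum_def)
  have "(spectral_sum c * spectral_sum d) $$ (i, j)
      = (\<Sum>k<n. spectral_sum c $$ (i, k) * spectral_sum d $$ (k, j))"
    using ij spectral_sum_carrier[of c] spectral_sum_carrier[of d]
    by (simp add: scalar_prod_def atLeast0LessThan)
  also have "\<dots> = (\<Sum>k<n. \<Sum>r=1..m. \<Sum>s=1..m. c r * d s * (E r $$ (i, k) * E s $$ (k, j)))"
    using ij by (intro sum.cong refl) (simp add: spectral_sum_index sum_product mult_ac)
  also have "\<dots> = (\<Sum>r=1..m. \<Sum>s=1..m. \<Sum>k<n. c r * d s * (E r $$ (i, k) * E s $$ (k, j)))"
    by (simp only: sum.swap[of _ _ "{..<n}"])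
  also have "\<dots> = (\<Sum>r=1..m. \<Sum>s=1..m. c r * d s * (E r * E s) $$ (i, j))"
  proof (intro sum.cong refl)
    fix r s assume "r \<in> {1..m}" "s \<in> {1..m}"
    then have "E r \<in> carrier_mat n n" "E s \<in> carrier_mat n n" using projection_carrier by auto
    then have "(E r * E s) $$ (i, j) = (\<Sum>k<n. E r $$ (i, k) * E s $$ (k, j))"
      using ij by (simp add: scalar_prod_def atLeast0LessThan)
    then show "(\<Sum>k<n. c r * d s * (E r $$ (i, k) * E s $$ (k, j)))
        = c r * d s * (E r * E s) $$ (i, j)"
      by (simp add: sum_distrib_left)
  qed
  also have "\<dots> = (\<Sum>r=1..m. \<Sum>s=1..m. if r = s then c r * d r * E r $$ (i, j) else 0)"
    using ij by (intro sum.cong refl) (simp add: projection_mult)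
  also have "\<dots> = spectral_sum (\<lambda>r. c r * d r) $$ (i, j)"
    using ij by (simp add: spectral_sum_index)
  finally show "(spectral_sum c * spectral_sum d) $$ (i, j)
    = spectral_sum (\<lambda>r. c r * d r) $$ (i, j)" .
qed (auto simp: spectral_sum_def)

lemma spectral_sum_mult_vec_index:
  assumes v: "v \<in> carrier_vec n" and i: "i < n"
  shows "(spectral_sum c *\<^sub>v v) $ i = (\<Sum>r=1..m. c r * (E r *\<^sub>v v) $ i)"
proof -
  have "(spectral_sum c *\<^sub>v v) $ i = (\<Sum>k<n. \<Sum>r=1..m. c r * (E r $$ (i, k) * v $ k))"
    using v i spectral_sum_carrier[of c]
    by (auto simp: scalar_prod_def atLeast0LessThan spectral_sum_index sum_distrib_right mult.assoc
        intro!: sum.cong)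
  also have "\<dots> = (\<Sum>r=1..m. c r * (\<Sum>k<n. E r $$ (i, k) * v $ k))"
    by (subst sum.swap) (simp add: sum_distrib_left)
  also have "\<dots> = (\<Sum>r=1..m. c r * (E r *\<^sub>v v) $ i)"
  proof (intro sum.cong refl)
    fix r assume "r \<in> {1..m}"
    then show "c r * (\<Sum>k<n. E r $$ (i, k) * v $ k) = c r * (E r *\<^sub>v v) $ i"
      using projection_carrier[of r] v i by (simp add: scalar_prod_def atLeast0LessThan)
  qed
  finally show ?thesis .
qed

text \<open>Completeness needs no spectral theorem: the defect of a vector is orthogonal to every
  eigenspace, hence killed by \<open>A = \<Sum> \<theta> r E r\<close>, hence itself in an eigenspace unless it vanishes.\<close>

lemma spectral_sum_one: "spectral_sum (\<lambda>_. 1) = 1\<^sub>m n"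
proof (rule mat_eq_by_mult_vec)
  let ?S = "spectral_sum (\<lambda>_. 1)"
  fix v :: "real vec" assume v: "v \<in> carrier_vec n"
  define w where "w = v - ?S *\<^sub>v v"
  have Sv: "?S *\<^sub>v v \<in> carrier_vec n" by (rule mult_mat_vec_carrier[OF spectral_sum_carrier v])
  have wc: "w \<in> carrier_vec n" unfolding w_def using v Sv by auto
  have orth: "w \<bullet> u = 0" if r: "r \<in> {1..m}" and u: "u \<in> eigenspace A (\<theta> r)" for r u
  proof -
    have uc: "u \<in> carrier_vec n" using u by (rule eigenspace_carrier)
    have "(?S *\<^sub>v v) \<bullet> u = (\<Sum>i<n. \<Sum>s=1..m. (E s *\<^sub>v v) $ i * u $ i)"
      using uc v unfolding scalar_prod_def
      by (auto simp: atLeast0LessThan spectral_sum_mult_vec_index sum_distrib_right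
          simp del: index_mult_mat_vec intro!: sum.cong)
    also have "\<dots> = (\<Sum>s=1..m. (E s *\<^sub>v v) \<bullet> u)"
      using uc by (subst sum.swap) (simp add: scalar_prod_def atLeast0LessThan)
    also have "\<dots> = (\<Sum>s=1..m. if s = r then v \<bullet> u else 0)"
    proof (intro sum.cong refl)
      fix s assume s: "s \<in> {1..m}"
      show "(E s *\<^sub>v v) \<bullet> u = (if s = r then v \<bullet> u else 0)"
      proof (cases "s = r")
        case True
        then show ?thesis using projection_scalar_prod[OF r v u] by simp
      next
        case False
        then have "\<theta> s \<noteq> \<theta> r" using inj_theta r s by (metis inj_on_def)
        then show ?thesis
          using eigenspaces_orthogonal[OF projection_range[OF s v] u] False by simp
      qed
    qed
    also have "\<dots> = v \<bullet> u" using r by simp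
    finally show ?thesis unfolding w_def
      using minus_scalar_prod_distrib[OF v Sv uc] by simp
  qed
  have "A *\<^sub>v w = 0\<^sub>v n"
  proof (rule eq_vecI)
    fix i assume "i < dim_vec (0\<^sub>v n :: real vec)"
    then have i: "i < n" by simp
    have "(A *\<^sub>v w) $ i = (\<Sum>r=1..m. \<theta> r * (E r *\<^sub>v w) $ i)"
      using spectral_sum_mult_vec_index[OF wc i, of \<theta>] by (simp only: spectral_sum_theta)
    also have "\<dots> = (\<Sum>r=1..m. \<theta> r * (0\<^sub>v n) $ i)"
    proof (intro sum.cong refl)
      fix r assume r: "r \<in> {1..m}"
      then show "\<theta> r * (E r *\<^sub>v w) $ i = \<theta> r * (0\<^sub>v n) $ i"
        using projection_orthogonal_vec[OF r wc orth[OF r]] by simp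
    qed
    finally show "(A *\<^sub>v w) $ i = 0\<^sub>v n $ i" using i by simp
  qed (use carrier in auto)
  then have w0: "w \<in> eigenspace A 0" using wc carrier by (auto simp: eigenspace_def)
  have "w = 0\<^sub>v n"
  proof (rule ccontr)
    assume "w \<noteq> 0\<^sub>v n"
    then have "eigenvalue A 0"
      using w0 wc carrier by (auto simp: eigenvalue_def eigenvector_def eigenspace_def)
    then obtain r where "r \<in> {1..m}" "\<theta> r = 0" using theta_image by force
    then have "w \<bullet> w = 0" using orth w0 by metis
    with \<open>w \<noteq> 0\<^sub>v n\<close> show False using scalar_prod_self_eq_0 wc by blast
  qed
  then have "\<And>i. i < n \<Longrightarrow> v $ i - (?S *\<^sub>v v) $ i = 0"
    using v Sv unfolding w_def by (metis carrier_vecD index_minus_vec(1) index_zero_vec(1))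
  then have "?S *\<^sub>v v = v" using v Sv by (intro eq_vecI) auto
  then show "?S *\<^sub>v v = 1\<^sub>m n *\<^sub>v v" using v by simp
qed auto

lemma pow_mat_spectral: "A ^\<^sub>m k = spectral_sum (\<lambda>r. \<theta> r ^ k)"
proof (induction k)
  case 0
  then show ?case using carrier by (simp add: spectral_sum_one)
next
  case (Suc k)
  have "A ^\<^sub>m Suc k = spectral_sum (\<lambda>r. \<theta> r ^ k) * spectral_sum \<theta>"
    using Suc by (simp add: spectral_sum_theta)
  then show ?case by (simp add: spectral_sum_mult mult.commute)
qed

lemma shift_spectral: "t \<cdot>\<^sub>m 1\<^sub>m n - A = spectral_sum (\<lambda>r. t - \<theta> r)"
proof (rule eq_matI)
  fix i j assume "i < dim_row (spectral_sum (\<lambda>r. t - \<theta> r))" "j < dim_col (spectral_sum (\<lambda>r. t - \<theta> r))"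
  then have ij: "i < n" "j < n" by (auto simp: spectral_sum_def)
  have "1\<^sub>m n $$ (i, j) = (\<Sum>r=1..m. E r $$ (i, j))"
    using arg_cong[OF spectral_sum_one, of "\<lambda>M. M $$ (i, j)"] ij by (simp add: spectral_sum_index)
  moreover have "A $$ (i, j) = (\<Sum>r=1..m. \<theta> r * E r $$ (i, j))"
    using arg_cong[OF spectral_sum_theta, of "\<lambda>M. M $$ (i, j)"] ij by (simp add: spectral_sum_index)
  ultimately show "(t \<cdot>\<^sub>m 1\<^sub>m n - A) $$ (i, j) = spectral_sum (\<lambda>r. t - \<theta> r) $$ (i, j)"
    using ij carrier
    by (simp add: spectral_sum_index sum_distrib_left[symmetric] sum_subtractf left_diff_distrib
        split: if_splits)
qed (use carrier in \<open>auto simp: spectral_sum_def\<close>)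

section \<open>Resolvent, inverse and adjugate of \<open>t I - A\<close>\<close>

definition resolvent :: "real \<Rightarrow> real mat" where
  "resolvent t = spectral_sum (\<lambda>r. 1 / (t - \<theta> r))"

lemma resolvent_carrier [simp]: "resolvent t \<in> carrier_mat n n"
  by (simp add: resolvent_def)

lemma resolvent_dim [simp]: "dim_row (resolvent t) = n" "dim_col (resolvent t) = n"
  by (simp_all add: resolvent_def)

lemma resolvent_index:
  "i < n \<Longrightarrow> j < n \<Longrightarrow> resolvent t $$ (i, j) = (\<Sum>r=1..m. E r $$ (i, j) / (t - \<theta> r))"
  by (simp add: resolvent_def spectral_sum_index)

lemma shift_carrier [simp]: "t \<cdot>\<^sub>m 1\<^sub>m n - A \<in> carrier_mat n n"
  using carrier by auto

lemma shift_mult_resolvent: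
  assumes "t \<notin> \<theta> ` {1..m}"
  shows "(t \<cdot>\<^sub>m 1\<^sub>m n - A) * resolvent t = 1\<^sub>m n"
proof -
  have "spectral_sum (\<lambda>r. (t - \<theta> r) * (1 / (t - \<theta> r))) = spectral_sum (\<lambda>_. 1)"
    unfolding spectral_sum_def using assms
    by (intro cong_mat refl) (auto intro!: sum.cong)
  then show ?thesis
    by (simp only: shift_spectral resolvent_def spectral_sum_mult spectral_sum_one)
qed

lemma resolvent_mult_shift:
  "t \<notin> \<theta> ` {1..m} \<Longrightarrow> resolvent t * (t \<cdot>\<^sub>m 1\<^sub>m n - A) = 1\<^sub>m n"
  by (rule mat_mult_left_right_inverse[OF shift_carrier resolvent_carrier shift_mult_resolvent])

lemma det_shift: "det (t \<cdot>\<^sub>m 1\<^sub>m n - A) = poly (char_poly A) t"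
  unfolding char_poly_def
  by (rule poly_det_cong[symmetric, of _ n]) (use carrier in \<open>auto simp: char_poly_matrix_def\<close>)

lemma det_shift_eq_0_iff: "det (t \<cdot>\<^sub>m 1\<^sub>m n - A) = 0 \<longleftrightarrow> t \<in> \<theta> ` {1..m}"
  unfolding det_shift theta_image using eigenvalue_root_char_poly[OF carrier] by simp

text \<open>A right inverse forces a nonzero determinant, so \<open>t\<close> is off the spectrum,
  and it must then equal the two-sided inverse \<open>resolvent t\<close>. Off the spectrum the
  matrix is a unit, so the computed inverse exists.\<close>

lemma mat_inverse_shift:
  "mat_inverse (t \<cdot>\<^sub>m 1\<^sub>m n - A) = Some B \<longleftrightarrow> t \<notin> \<theta> ` {1..m} \<and> B = resolvent t"
proof -
  have B_eq: "t \<notin> \<theta> ` {1..m} \<and> B = resolvent t"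
    if "mat_inverse (t \<cdot>\<^sub>m 1\<^sub>m n - A) = Some B" for B
  proof -
    have B: "(t \<cdot>\<^sub>m 1\<^sub>m n - A) * B = 1\<^sub>m n" "B \<in> carrier_mat n n"
      using mat_inverse(2)[OF shift_carrier that] by auto
    have "det (t \<cdot>\<^sub>m 1\<^sub>m n - A) * det B = 1"
      using det_mult[OF shift_carrier B(2), of t] B(1) by simp
    then have t: "t \<notin> \<theta> ` {1..m}" using det_shift_eq_0_iff by force
    have "B = (resolvent t * (t \<cdot>\<^sub>m 1\<^sub>m n - A)) * B"
      using resolvent_mult_shift[OF t] B(2) by simp
    also have "\<dots> = resolvent t"
      using B by (subst assoc_mult_mat[OF resolvent_carrier shift_carrier]) auto
    finally show ?thesis using t by simp
  qed
  moreover have "mat_inverse (t \<cdot>\<^sub>m 1\<^sub>m n - A) \<noteq> None" if "t \<notin> \<theta> ` {1..m}"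
    using mat_inverse(1)[OF shift_carrier] det_non_zero_imp_unit[OF shift_carrier]
      that det_shift_eq_0_iff by metis
  ultimately show ?thesis by (metis not_None_eq)
qed

text \<open>Multiply \<open>M * adj_mat M = det M \<cdot>\<^sub>m 1\<^sub>m n\<close> on the left by
  the inverse of \<open>M\<close>.\<close>

lemma adj_mat_shift:
  assumes "t \<notin> \<theta> ` {1..m}"
  shows "adj_mat (t \<cdot>\<^sub>m 1\<^sub>m n - A) = det (t \<cdot>\<^sub>m 1\<^sub>m n - A) \<cdot>\<^sub>m resolvent t"
proof -
  let ?M = "t \<cdot>\<^sub>m 1\<^sub>m n - A"
  note adj = adj_mat[OF shift_carrier, of t]
  have "adj_mat ?M = (resolvent t * ?M) * adj_mat ?M"
    using resolvent_mult_shift[OF assms] adj(1) by simp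
  also have "\<dots> = resolvent t * (det ?M \<cdot>\<^sub>m 1\<^sub>m n)"
    using adj by (subst assoc_mult_mat[OF resolvent_carrier shift_carrier]) auto
  also have "\<dots> = det ?M \<cdot>\<^sub>m resolvent t"
    by (simp add: mult_smult_distrib[of _ n n _ n])
  finally show ?thesis .
qed

text \<open>Distinct eigenvalues are distinct roots of a polynomial of degree \<open>n\<close>. This
  bound is why the powers below \<open>n\<close> suffice to recover all the
  \<open>E r\<close>.\<close>

lemma card_eigenvalues_le: "m \<le> n"
proof -
  have "char_poly A \<noteq> 0" using degree_monic_char_poly[OF carrier] by auto
  then have "card {x. poly (char_poly A) x = 0} \<le> n"
    using card_poly_roots_bound[of "char_poly A"] degree_monic_char_poly[OF carrier] by simp
  moreover have "card (\<theta> ` {1..m}) = m" using inj_theta by (simp add: card_image)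
  ultimately show ?thesis
    using theta_image eigenvalue_root_char_poly[OF carrier] by simp
qed

end

section \<open>Jacobi's identity for complementary principal minors\<close>

text \<open>Let \<open>C\<close> consist of the first \<open>k\<close> columns of \<open>N\<close>
  followed by unit vectors. Then \<open>C\<close> and \<open>M * C\<close> are both block
  triangular, with determinants the leading block of \<open>N\<close> and the trailing block of
  \<open>M\<close>; compare them by multiplicativity.\<close>

lemma det_inverse_leading_block:
  fixes M N :: "'a :: idom mat"
  assumes M: "M \<in> carrier_mat (k + l) (k + l)" and N: "N \<in> carrier_mat (k + l) (k + l)"
    and MN: "M * N = 1\<^sub>m (k + l)"
  shows "det M * det (mat k k (\<lambda>(i, j). N $$ (i, j))) = det (mat l l (\<lambda>(i, j). M $$ (i + k, j + k)))"
proof -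
  let ?N1 = "mat k k (\<lambda>(i, j). N $$ (i, j))"
  let ?N3 = "mat l k (\<lambda>(i, j). N $$ (i + k, j))"
  let ?M2 = "mat k l (\<lambda>(i, j). M $$ (i, j + k))"
  let ?M4 = "mat l l (\<lambda>(i, j). M $$ (i + k, j + k))"
  define C where "C = four_block_mat ?N1 (0\<^sub>m k l) ?N3 (1\<^sub>m l)"
  have C: "C \<in> carrier_mat (k + l) (k + l)" by (auto simp: C_def)
  \<comment> \<open>The product is read off by columns: the first \<open>k\<close> columns of
    \<open>M * C\<close> are those of \<open>M * N = 1\<close>, the others are those of
    \<open>M\<close>.\<close>
  have col1: "col C j = col N j" if "j < k" for j
    using that N by (intro eq_vecI) (auto simp: C_def)
  have col2: "col C j = unit_vec (k + l) j" if "k \<le> j" "j < k + l" for j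
    using that by (intro eq_vecI) (auto simp: C_def)
  have "M * C = four_block_mat (1\<^sub>m k) ?M2 (0\<^sub>m l k) ?M4"
  proof (rule eq_matI)
    fix i j assume "i < dim_row (four_block_mat (1\<^sub>m k) ?M2 (0\<^sub>m l k) ?M4)"
      "j < dim_col (four_block_mat (1\<^sub>m k) ?M2 (0\<^sub>m l k) ?M4)"
    then have ij: "i < k + l" "j < k + l" by auto
    show "(M * C) $$ (i, j) = four_block_mat (1\<^sub>m k) ?M2 (0\<^sub>m l k) ?M4 $$ (i, j)"
    proof (cases "j < k")
      case True
      have "(M * C) $$ (i, j) = (M * N) $$ (i, j)"
        using ij M N C col1[OF True] by simp
      then show ?thesis using ij True by (simp add: MN)
    next
      case False
      then have "(M * C) $$ (i, j) = M $$ (i, j)"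
        using ij M C col2[of j] by simp
      then show ?thesis using ij False by simp
    qed
  qed (use M C in auto)
  then have "det M * det C = det (four_block_mat (1\<^sub>m k) ?M2 (0\<^sub>m l k) ?M4)"
    using det_mult[OF M C] by simp
  also have "\<dots> = det ?M4"
    by (subst det_four_block_mat_lower_left_zero[of _ k _ l]) auto
  also have "det C = det ?N1"
    unfolding C_def by (subst det_four_block_mat_upper_right_zero[of _ k _ l]) auto
  finally show ?thesis .
qed

text \<open>The sign of \<open>p\<close> enters once for the rows and once for the columns, and its
  square is 1.\<close>

lemma det_permute_rows_cols:
  fixes M :: "'a :: comm_ring_1 mat"
  assumes M: "M \<in> carrier_mat n n" and p: "p permutes {0..<n}"
  shows "det (mat n n (\<lambda>(i, j). M $$ (p i, p j))) = det M"
proof -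
  have p_less: "p i < n" if "i < n" for i using permutes_in_image[OF p, of i] that by simp
  let ?C = "mat n n (\<lambda>(i, j). M $$ (i, p j))"
  have "mat n n (\<lambda>(i, j). M $$ (p i, p j)) = mat n n (\<lambda>(i, j). ?C $$ (p i, j))"
    by (rule eq_matI) (auto simp: p_less)
  then have "det (mat n n (\<lambda>(i, j). M $$ (p i, p j))) = signof p * det ?C"
    using det_permute_rows[OF _ p, of ?C] by simp
  also have "?C = (mat n n (\<lambda>(i, j). M\<^sup>T $$ (p i, j)))\<^sup>T"
    using M by (intro eq_matI) (auto simp: p_less)
  also have "det \<dots> = det (mat n n (\<lambda>(i, j). M\<^sup>T $$ (p i, j)))"
    by (rule det_transpose[of _ n]) simp
  also have "\<dots> = signof p * det M"
    using det_permute_rows[OF _ p, of "M\<^sup>T"] det_transpose[OF M] M by simp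
  finally show ?thesis by (cases p rule: sign_cases) simp_all
qed

text \<open>Conjugating by \<open>p\<close> preserves \<open>M * N = 1\<close> and moves the chosen
  indices to the front, which reduces the claim to leading blocks.\<close>

lemma det_inverse_principal_block:
  fixes M N :: "'a :: idom mat"
  assumes M: "M \<in> carrier_mat (k + l) (k + l)" and N: "N \<in> carrier_mat (k + l) (k + l)"
    and MN: "M * N = 1\<^sub>m (k + l)" and p: "p permutes {0..<k + l}"
  shows "det M * det (mat k k (\<lambda>(i, j). N $$ (p i, p j)))
    = det (mat l l (\<lambda>(i, j). M $$ (p (i + k), p (j + k))))"
proof -
  let ?n = "k + l"
  let ?M = "mat ?n ?n (\<lambda>(i, j). M $$ (p i, p j))" and ?N = "mat ?n ?n (\<lambda>(i, j). N $$ (p i, p j))"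
  have p_less: "p i < ?n" if "i < ?n" for i using permutes_in_image[OF p, of i] that by simp
  have "?M * ?N = 1\<^sub>m ?n"
  proof (rule eq_matI)
    fix i j assume "i < dim_row (1\<^sub>m ?n :: 'a mat)" "j < dim_col (1\<^sub>m ?n :: 'a mat)"
    then have ij: "i < ?n" "j < ?n" by auto
    have "(?M * ?N) $$ (i, j) = (\<Sum>q\<in>{0..<?n}. M $$ (p i, p q) * N $$ (p q, p j))"
      using ij by (auto simp: scalar_prod_def intro!: sum.cong)
    also have "\<dots> = (\<Sum>q\<in>{0..<?n}. M $$ (p i, q) * N $$ (q, p j))"
      using sum.permute[OF p, of "\<lambda>q. M $$ (p i, q) * N $$ (q, p j)"] by (simp add: o_def)
    also have "\<dots> = (M * N) $$ (p i, p j)"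
      using ij p_less M N by (simp add: scalar_prod_def)
    also have "\<dots> = 1\<^sub>m ?n $$ (i, j)"
      using ij p_less permutes_inj[OF p] by (simp add: MN inj_eq)
    finally show "(?M * ?N) $$ (i, j) = 1\<^sub>m ?n $$ (i, j)" .
  qed auto
  then have "det ?M * det (mat k k (\<lambda>(i, j). ?N $$ (i, j))) = det (mat l l (\<lambda>(i, j). ?M $$ (i + k, j + k)))"
    by (intro det_inverse_leading_block) auto
  moreover have "mat k k (\<lambda>(i, j). ?N $$ (i, j)) = mat k k (\<lambda>(i, j). N $$ (p i, p j))"
    by (rule eq_matI) auto
  moreover have "mat l l (\<lambda>(i, j). ?M $$ (i + k, j + k)) = mat l l (\<lambda>(i, j). M $$ (p (i + k), p (j + k)))"
    by (rule eq_matI) auto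
  ultimately show ?thesis using det_permute_rows_cols[OF M p] by simp
qed

lemma det_two_by_two:
  fixes M :: "'a :: comm_ring_1 mat"
  assumes M: "M \<in> carrier_mat 2 2"
  shows "det M = M $$ (0, 0) * M $$ (1, 1) - M $$ (0, 1) * M $$ (1, 0)"
proof -
  have minors: "det (mat_delete M 0 0) = M $$ (1, 1)" "det (mat_delete M 0 1) = M $$ (1, 0)"
    using M by (subst det_single; auto simp: mat_delete_def)+
  have "det M = (\<Sum>j<2. M $$ (0, j) * cofactor M 0 j)"
    by (rule laplace_expansion_row[OF M]) simp
  then show ?thesis by (simp add: numeral_2_eq_2 cofactor_def minors[simplified])
qed

section \<open>Walk counts and vertex-deleted subgraphs through the adjacency matrix\<close>

text \<open>Powers unfold on the right; a factor on the left is what matches splitting a walk at its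
  first arc.\<close>

lemma pow_mat_Suc_left:
  fixes M :: "'a :: semiring_1 mat"
  assumes M: "M \<in> carrier_mat n n"
  shows "M ^\<^sub>m Suc k = M * M ^\<^sub>m k"
proof (induction k)
  case (Suc k)
  have "M ^\<^sub>m Suc (Suc k) = (M * M ^\<^sub>m k) * M" using Suc by simp
  also have "\<dots> = M * (M ^\<^sub>m k * M)" using M by (intro assoc_mult_mat) auto
  finally show ?case by simp
qed (use M in simp)

lemma vertex_list:
  assumes "finite (verts G)"
  shows "distinct (vertex_list G)" "set (vertex_list G) = verts G"
proof -
  have "\<exists>vs. distinct vs \<and> set vs = verts G" using finite_distinct_list[OF assms] by auto
  from someI_ex[OF this] show "distinct (vertex_list G)" "set (vertex_list G) = verts G"
    by (simp_all add: vertex_list_def)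
qed

lemma length_vertex_list: "finite (verts G) \<Longrightarrow> length (vertex_list G) = card (verts G)"
  using vertex_list[of G] distinct_card by metis

lemma adjacency_matrix_carrier: "adjacency_matrix G \<in> carrier_mat (card (verts G)) (card (verts G))"
  by (simp add: adjacency_matrix_def)

lemma adjacency_matrix_index:
  "i < card (verts G) \<Longrightarrow> j < card (verts G) \<Longrightarrow>
    adjacency_matrix G $$ (i, j) = (if vertex_list G ! i \<rightarrow>\<^bsub>G\<^esub> vertex_list G ! j then 1 else 0)"
  by (simp add: adjacency_matrix_def)

lemma dominates_induce_subgraph_iff:
  "u \<rightarrow>\<^bsub>G \<restriction> S\<^esub> v \<longleftrightarrow> u \<rightarrow>\<^bsub>G\<^esub> v \<and> u \<in> S \<and> v \<in> S"
  by (auto simp: arcs_ends_conv)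

context graph
begin

lemma adjacency_matrix_symmetric: "(adjacency_matrix G)\<^sup>T = adjacency_matrix G"
  using adjacency_matrix_carrier[of G]
  by (intro eq_matI) (auto simp: adjacency_matrix_index graph_symmetric)

lemma finite_awalks_of_length: "finite {p. awalk u p v \<and> length p = k}"
  by (rule finite_subset[OF _ finite_lists_length_eq[OF finite_arcs, of k]]) (auto simp: awalk_def)

text \<open>Walks are split by their first arc. As there are no parallel arcs, the arcs leaving
  \<open>u\<close> correspond bijectively to the vertices that \<open>u\<close> dominates.\<close>

lemma num_walks_Suc:
  assumes "u \<in> verts G"
  shows "num_walks G (Suc k) u v = (\<Sum>w\<in>{w \<in> verts G. u \<rightarrow> w}. num_walks G k w v)"
proof -
  let ?W = "\<lambda>k u. {p. awalk u p v \<and> length p = k}"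
  let ?out = "{e \<in> arcs G. tail G e = u}"
  have "?W (Suc k) u = (\<Union>e\<in>?out. (#) e ` ?W k (head G e))"
    by (auto simp: length_Suc_conv awalk_Cons_iff)
  then have "num_walks G (Suc k) u v = card (\<Union>e\<in>?out. (#) e ` ?W k (head G e))"
    by (simp add: num_walks_def)
  also have "\<dots> = (\<Sum>e\<in>?out. card ((#) e ` ?W k (head G e)))"
    by (rule card_UN_disjoint) (auto simp: finite_awalks_of_length)
  also have "\<dots> = (\<Sum>e\<in>?out. num_walks G k (head G e) v)"
    by (simp add: card_image num_walks_def)
  also have "\<dots> = (\<Sum>w\<in>head G ` ?out. num_walks G k w v)"
    using no_multi_arcs by (subst sum.reindex) (auto simp: inj_on_def arc_to_ends_def)
  also have "head G ` ?out = {w \<in> verts G. u \<rightarrow> w}"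
    by (auto simp: arcs_ends_conv)
  finally show ?thesis .
qed

lemma pow_adjacency_matrix_index:
  assumes "i < card (verts G)" and j: "j < card (verts G)"
  shows "(adjacency_matrix G ^\<^sub>m k) $$ (i, j)
    = real (num_walks G k (vertex_list G ! i) (vertex_list G ! j))"
  using assms(1)
proof (induction k arbitrary: i)
  case 0
  have "num_walks G 0 u v = (if u = v then 1 else 0)" if "u \<in> verts G" for u v
  proof -
    have "{p. awalk u p v \<and> length p = 0} = (if u = v then {[]} else {})"
      using that by (auto simp: awalk_Nil_iff)
    then show ?thesis by (simp add: num_walks_def)
  qed
  moreover have "vertex_list G ! i \<in> verts G"
    using 0 vertex_list(2)[of G] length_vertex_list[of G] nth_mem[of i "vertex_list G"] by simp
  moreover have "vertex_list G ! i = vertex_list G ! j \<longleftrightarrow> i = j"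
    using 0 j by (intro nth_eq_iff_index_eq) (auto simp: vertex_list length_vertex_list)
  ultimately show ?case using 0 j adjacency_matrix_carrier[of G] by simp
next
  case (Suc k)
  let ?n = "card (verts G)" and ?vs = "vertex_list G" and ?A = "adjacency_matrix G"
  have bij: "bij_betw ((!) ?vs) {..<?n} (verts G)"
    by (intro bij_betw_nth) (auto simp: vertex_list length_vertex_list)
  have i: "?vs ! i \<in> verts G" using bij Suc.prems by (auto simp: bij_betw_def)
  have "(?A ^\<^sub>m Suc k) $$ (i, j) = (?A * ?A ^\<^sub>m k) $$ (i, j)"
    by (simp only: pow_mat_Suc_left[OF adjacency_matrix_carrier])
  also have "\<dots> = (\<Sum>q<?n. ?A $$ (i, q) * (?A ^\<^sub>m k) $$ (q, j))"
    using Suc.prems j adjacency_matrix_carrier[of G]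
    by (simp add: scalar_prod_def atLeast0LessThan)
  also have "\<dots> = (\<Sum>q<?n. if ?vs ! i \<rightarrow> ?vs ! q then real (num_walks G k (?vs ! q) (?vs ! j)) else 0)"
    using Suc.prems by (intro sum.cong refl) (simp add: adjacency_matrix_index Suc.IH)
  also have "\<dots> = (\<Sum>w\<in>verts G. if ?vs ! i \<rightarrow> w then real (num_walks G k w (?vs ! j)) else 0)"
    by (rule sum.reindex_bij_betw[OF bij])
  also have "\<dots> = real (num_walks G (Suc k) (?vs ! i) (?vs ! j))"
    by (simp add: num_walks_Suc[OF i] sum.inter_filter if_distrib[of real] cong: if_cong)
  finally show ?case .
qed

text \<open>Deleting the vertices at positions \<open>is\<close> leaves, up to reordering, the
  complementary principal submatrix of \<open>t I - A\<close>, so Jacobi's identity applies. The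
  reordering is needed because the subgraph has its own arbitrarily chosen vertex listing.\<close>

lemma poly_char_poly_delete_verts:
  assumes dist: "distinct is" and sub: "set is \<subseteq> {..<card (verts G)}"
    and M: "M = t \<cdot>\<^sub>m 1\<^sub>m (card (verts G)) - adjacency_matrix G"
    and N: "N \<in> carrier_mat (card (verts G)) (card (verts G))"
    and MN: "M * N = 1\<^sub>m (card (verts G))"
  shows "poly (graph_char_poly (delete_verts G ((!) (vertex_list G) ` set is))) t
    = det M * det (mat (length is) (length is) (\<lambda>(i, j). N $$ (is ! i, is ! j)))"
proof -
  let ?n = "card (verts G)" and ?vs = "vertex_list G" and ?A = "adjacency_matrix G"
  define H where "H = delete_verts G ((!) ?vs ` set is)"
  define us where "us = map ((!) ?vs) is"
  define ws where "ws = vertex_list H"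
  define k l where "k = length is" and "l = card (verts H)"
  have vs: "distinct ?vs" "set ?vs = verts G" "length ?vs = ?n"
    by (auto simp: vertex_list length_vertex_list)
  have bij: "bij_betw ((!) ?vs) {..<?n} (verts G)"
    by (intro bij_betw_nth) (auto simp: vs)
  have us: "distinct us" "set us = (!) ?vs ` set is" "length us = k"
    using dist sub bij by (auto simp: us_def k_def distinct_map bij_betw_def intro: inj_on_subset)
  have H: "verts H = verts G - set us" by (simp add: H_def delete_verts_def us)
  then have ws: "distinct ws" "set ws = verts G - set us" "length ws = l"
    using vertex_list[of H] length_vertex_list[of H] by (simp_all add: ws_def l_def)
  have "set us \<subseteq> verts G" using us sub bij by (auto simp: bij_betw_def)
  then have uw: "distinct (us @ ws)" "set (us @ ws) = set ?vs" using us ws vs by auto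
  \<comment> \<open>Deleted vertices followed by the listing of the subgraph form another listing of
    all vertices. Equal multisets differ by a permutation \<open>p\<close> of positions, which sends
    the first \<open>k\<close> positions to \<open>is\<close> and the rest to the positions of the
    surviving vertices.\<close>
  then have "mset (us @ ws) = mset ?vs" using vs by (metis mset_set_set)
  then obtain p where p: "p permutes {..<?n}" "permute_list p ?vs = us @ ws"
    using mset_eq_permutation[of "us @ ws" ?vs] vs by metis
  have n: "?n = k + l" using p(2) us ws vs length_permute_list[of p ?vs] by simp
  have p_less: "p i < ?n" if "i < ?n" for i using permutes_in_image[OF p(1), of i] that by simp
  have nth: "(us @ ws) ! i = ?vs ! p i" if "i < ?n" for i
    using that p vs permute_list_nth[of p ?vs i] by simp
  have p_is: "p i = is ! i" if i: "i < k" for i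
  proof -
    have "?vs ! (is ! i) = ?vs ! p i" using nth[of i] i n us by (simp add: nth_append us_def k_def)
    moreover have "is ! i < ?n" using sub i by (auto simp: k_def dest: nth_mem)
    ultimately show ?thesis using p_less[of i] i n vs by (simp add: nth_eq_iff_index_eq)
  qed
  have ws_nth: "ws ! i = ?vs ! p (i + k)" if "i < l" for i
    using nth[of "i + k"] that n us by (simp add: nth_append)
  have Mc: "M \<in> carrier_mat ?n ?n" using M adjacency_matrix_carrier[of G] by auto
  have entry: "poly (char_poly_matrix (adjacency_matrix H) $$ (i, j)) t = M $$ (p (i + k), p (j + k))"
    if ij: "i < l" "j < l" for i j
  proof -
    have pl: "p (i + k) < ?n" "p (j + k) < ?n" using p_less ij n by auto
    have mem: "ws ! i \<in> verts H" "ws ! j \<in> verts H" using ij ws H nth_mem[of i ws] nth_mem[of j ws] by simp_all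
    have "adjacency_matrix H $$ (i, j) = ?A $$ (p (i + k), p (j + k))"
      using ij pl mem ws_nth H us unfolding l_def
      by (auto simp: adjacency_matrix_index ws_def H_def delete_verts_def dominates_induce_subgraph_iff)
    moreover have "i = j \<longleftrightarrow> p (i + k) = p (j + k)" using permutes_inj[OF p(1)] by (auto simp: inj_eq)
    ultimately show ?thesis
      using ij pl adjacency_matrix_carrier[of H] adjacency_matrix_carrier[of G]
      by (auto simp: M char_poly_matrix_def l_def)
  qed
  have "poly (graph_char_poly H) t = det (mat l l (\<lambda>(i, j). M $$ (p (i + k), p (j + k))))"
    unfolding graph_char_poly_def char_poly_def
    using adjacency_matrix_carrier[of H] entry by (intro poly_det_cong[of _ l]) (auto simp: l_def)
  also have "\<dots> = det M * det (mat k k (\<lambda>(i, j). N $$ (p i, p j)))"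
    using Mc N MN p(1) n
    by (intro det_inverse_principal_block[symmetric]) (auto simp: atLeast0LessThan)
  also have "mat k k (\<lambda>(i, j). N $$ (p i, p j)) = mat k k (\<lambda>(i, j). N $$ (is ! i, is ! j))"
    by (rule eq_matI) (auto simp: p_is)
  finally show ?thesis by (simp add: H_def k_def)
qed

end

section \<open>Comparing entries of powers, resolvent and idempotents\<close>

context symmetric_spectral
begin

text \<open>The transpose of the resolvent is again an inverse of the symmetric matrix
  \<open>t I - A\<close>, and inverses are unique.\<close>

lemma resolvent_symmetric:
  assumes "t \<notin> \<theta> ` {1..m}"
  shows "(resolvent t)\<^sup>T = resolvent t"
proof -
  let ?M = "t \<cdot>\<^sub>m 1\<^sub>m n - A"
  have "A $$ (j, i) = A $$ (i, j)" if "i < n" "j < n" for i j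
    using that symmetric carrier by (metis carrier_matD index_transpose_mat(1))
  then have MT: "?M\<^sup>T = ?M" using carrier by (intro eq_matI) auto
  have RT: "(resolvent t)\<^sup>T \<in> carrier_mat n n" by simp
  have "(resolvent t)\<^sup>T * ?M = (?M * resolvent t)\<^sup>T"
    using transpose_mult[OF shift_carrier resolvent_carrier, of t t] MT by simp
  then have "(resolvent t)\<^sup>T * ?M = 1\<^sub>m n" by (simp add: shift_mult_resolvent[OF assms])
  then have "((resolvent t)\<^sup>T * ?M) * resolvent t = resolvent t" by simp
  then show ?thesis
    using assoc_mult_mat[OF RT shift_carrier resolvent_carrier, of t t] shift_mult_resolvent[OF assms]
    by simp
qed

text \<open>The differences of entries of the powers are a Vandermonde system in the differences of
  entries of the \<open>E r\<close>. Exponents below \<open>m \<le> n\<close> determine the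
  solution, while the second claim covers every exponent.\<close>

lemma pow_entries_eq_iff:
  assumes ij: "i < n" "j < n" and kl: "k < n" "l < n"
  shows "(\<forall>q<n. (A ^\<^sub>m q) $$ (i, j) = (A ^\<^sub>m q) $$ (k, l))
    \<longleftrightarrow> (\<forall>r\<in>{1..m}. E r $$ (i, j) = E r $$ (k, l))"
    and "\<forall>r\<in>{1..m}. E r $$ (i, j) = E r $$ (k, l) \<Longrightarrow> (A ^\<^sub>m q) $$ (i, j) = (A ^\<^sub>m q) $$ (k, l)"
proof -
  let ?e = "\<lambda>r. E r $$ (i, j) - E r $$ (k, l)"
  have diff: "(A ^\<^sub>m q) $$ (i, j) - (A ^\<^sub>m q) $$ (k, l) = (\<Sum>r\<in>{1..m}. \<theta> r ^ q * ?e r)" for q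
    using assms
    by (simp add: pow_mat_spectral spectral_sum_index sum_subtractf right_diff_distrib)
  show imp: "(A ^\<^sub>m q) $$ (i, j) = (A ^\<^sub>m q) $$ (k, l)"
    if "\<forall>r\<in>{1..m}. E r $$ (i, j) = E r $$ (k, l)" for q
  proof -
    have "(\<Sum>r\<in>{1..m}. \<theta> r ^ q * ?e r) = 0" using that by (intro sum.neutral) auto
    with diff[of q] show ?thesis by simp
  qed
  have "?e r = 0"
    if pow: "\<forall>q<n. (A ^\<^sub>m q) $$ (i, j) = (A ^\<^sub>m q) $$ (k, l)" and r: "r \<in> {1..m}" for r
  proof (rule vandermonde_trivial_kernel[OF _ inj_theta _ r])
    fix q assume "q < card {1..m}"
    then have "q < n" using card_eigenvalues_le by simp
    then show "(\<Sum>r\<in>{1..m}. \<theta> r ^ q * ?e r) = 0" using pow diff[of q] by simp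
  qed simp
  with imp show "(\<forall>q<n. (A ^\<^sub>m q) $$ (i, j) = (A ^\<^sub>m q) $$ (k, l))
    \<longleftrightarrow> (\<forall>r\<in>{1..m}. E r $$ (i, j) = E r $$ (k, l))" by fastforce
qed

text \<open>Numerator of a resolvent entry over the common denominator \<open>\<Prod>s. (t - \<theta> s)\<close>.\<close>

definition resolvent_numerator :: "nat \<Rightarrow> nat \<Rightarrow> real poly" where
  "resolvent_numerator i j
    = (\<Sum>r=1..m. Polynomial.smult (E r $$ (i, j)) (\<Prod>s\<in>{1..m} - {r}. [:- \<theta> s, 1:]))"

lemma poly_resolvent_numerator:
  assumes "i < n" "j < n" and t: "t \<notin> \<theta> ` {1..m}"
  shows "poly (resolvent_numerator i j) t = (\<Prod>s=1..m. t - \<theta> s) * resolvent t $$ (i, j)"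
proof -
  have "(\<Prod>s=1..m. t - \<theta> s) * (E r $$ (i, j) / (t - \<theta> r))
      = E r $$ (i, j) * (\<Prod>s\<in>{1..m} - {r}. t - \<theta> s)" if r: "r \<in> {1..m}" for r
  proof -
    have "(\<Prod>s=1..m. t - \<theta> s) = (t - \<theta> r) * (\<Prod>s\<in>{1..m} - {r}. t - \<theta> s)"
      using r by (intro prod.remove) auto
    moreover have "t - \<theta> r \<noteq> 0" using t r by auto
    ultimately show ?thesis by simp
  qed
  then show ?thesis using assms
    by (simp add: resolvent_numerator_def resolvent_index poly_sum poly_prod sum_distrib_left)
qed

text \<open>Every summand other than the one for \<open>r\<close> contains the factor
  \<open>\<theta> r - \<theta> r\<close>. So evaluation at \<open>\<theta> r\<close> isolates the
  entry of \<open>E r\<close>, much like a residue.\<close>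

lemma poly_resolvent_numerator_theta:
  assumes r: "r \<in> {1..m}"
  shows "poly (resolvent_numerator i j) (\<theta> r)
    = E r $$ (i, j) * (\<Prod>s\<in>{1..m} - {r}. \<theta> r - \<theta> s)"
proof -
  have "poly (resolvent_numerator i j) (\<theta> r)
      = (\<Sum>q=1..m. E q $$ (i, j) * (\<Prod>s\<in>{1..m} - {q}. \<theta> r - \<theta> s))"
    by (simp add: resolvent_numerator_def poly_sum poly_prod)
  also have "\<dots> = (\<Sum>q\<in>{r}. E q $$ (i, j) * (\<Prod>s\<in>{1..m} - {q}. \<theta> r - \<theta> s))"
  proof (rule sum.mono_neutral_right)
    show "\<forall>q\<in>{1..m} - {r}. E q $$ (i, j) * (\<Prod>s\<in>{1..m} - {q}. \<theta> r - \<theta> s) = 0"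
    proof
      fix q assume "q \<in> {1..m} - {r}"
      then have "(\<Prod>s\<in>{1..m} - {q}. \<theta> r - \<theta> s) = 0"
        using r by (intro prod_zero bexI[of _ r]) auto
      then show "E q $$ (i, j) * (\<Prod>s\<in>{1..m} - {q}. \<theta> r - \<theta> s) = 0" by simp
    qed
  qed (use r in auto)
  finally show ?thesis by simp
qed

lemma theta_prod_nonzero:
  assumes "r \<in> {1..m}"
  shows "(\<Prod>s\<in>{1..m} - {r}. \<theta> r - \<theta> s) \<noteq> 0"
proof -
  have "\<theta> r \<noteq> \<theta> s" if "s \<in> {1..m} - {r}" for s
    using inj_theta assms that by (metis DiffD1 DiffD2 inj_on_def singletonI)
  then show ?thesis by auto
qed

text \<open>Agreement off the spectrum makes the two numerators equal as polynomials, and evaluation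
  at \<open>\<theta> r\<close> yields the entries of \<open>E r\<close> times a common nonzero
  factor.\<close>

lemma resolvent_entries_eq_iff:
  assumes ij: "i < n" "j < n" and kl: "k < n" "l < n"
  shows "(\<forall>t. t \<notin> \<theta> ` {1..m} \<longrightarrow> resolvent t $$ (i, j) = resolvent t $$ (k, l))
    \<longleftrightarrow> (\<forall>r\<in>{1..m}. E r $$ (i, j) = E r $$ (k, l))"
proof
  assume eq: "\<forall>t. t \<notin> \<theta> ` {1..m} \<longrightarrow> resolvent t $$ (i, j) = resolvent t $$ (k, l)"
  have "resolvent_numerator i j = resolvent_numerator k l"
    by (rule poly_eq_if_eq_off_finite[of "\<theta> ` {1..m}"])
      (auto simp: poly_resolvent_numerator assms eq)
  then show "\<forall>r\<in>{1..m}. E r $$ (i, j) = E r $$ (k, l)"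
    using poly_resolvent_numerator_theta theta_prod_nonzero by (metis mult_right_cancel)
next
  assume "\<forall>r\<in>{1..m}. E r $$ (i, j) = E r $$ (k, l)"
  then show "\<forall>t. t \<notin> \<theta> ` {1..m} \<longrightarrow> resolvent t $$ (i, j) = resolvent t $$ (k, l)"
    using assms by (simp add: resolvent_index)
qed

text \<open>Squares of resolvent entries determine the entries up to one sign common to all \<open>t\<close>, because
  polynomials form a domain; the entries of \<open>A\<close> then fix that sign.\<close>

lemma resolvent_squares_eq_imp:
  assumes ij: "i < n" "j < n" and kl: "k < n" "l < n"
    and sq: "\<And>t. t \<notin> \<theta> ` {1..m} \<Longrightarrow> (resolvent t $$ (i, j))\<^sup>2 = (resolvent t $$ (k, l))\<^sup>2"
    and A: "A $$ (i, j) = A $$ (k, l)" "A $$ (i, j) \<noteq> 0"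
  shows "\<forall>r\<in>{1..m}. E r $$ (i, j) = E r $$ (k, l)"
proof -
  let ?p = "resolvent_numerator i j" and ?q = "resolvent_numerator k l"
  have "?p\<^sup>2 = ?q\<^sup>2"
    by (rule poly_eq_if_eq_off_finite[of "\<theta> ` {1..m}"])
      (auto simp: poly_resolvent_numerator assms power_mult_distrib)
  then consider "?p = ?q" | "?p = - ?q" by (auto simp: power2_eq_iff)
  then show ?thesis
  proof cases
    case 1
    then show ?thesis
      using poly_resolvent_numerator_theta theta_prod_nonzero by (metis mult_right_cancel)
  next
    case 2
    have neg: "E r $$ (i, j) = - E r $$ (k, l)" if r: "r \<in> {1..m}" for r
    proof -
      have "poly ?p (\<theta> r) = - poly ?q (\<theta> r)" by (simp add: 2)
      then have "E r $$ (i, j) * (\<Prod>s\<in>{1..m} - {r}. \<theta> r - \<theta> s)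
          = (- E r $$ (k, l)) * (\<Prod>s\<in>{1..m} - {r}. \<theta> r - \<theta> s)"
        by (simp add: poly_resolvent_numerator_theta[OF r])
      then show ?thesis using theta_prod_nonzero[OF r] by (metis mult_right_cancel)
    qed
    have "A $$ (i, j) = (\<Sum>r=1..m. \<theta> r * E r $$ (i, j))"
      using spectral_sum_index[OF ij, of \<theta>] by (simp add: spectral_sum_theta)
    also have "\<dots> = - (\<Sum>r=1..m. \<theta> r * E r $$ (k, l))"
      unfolding sum_negf[symmetric] by (intro sum.cong refl) (simp add: neg)
    also have "\<dots> = - A $$ (k, l)"
      using spectral_sum_index[OF kl, of \<theta>] by (simp add: spectral_sum_theta)
    finally show ?thesis using A by simp
  qed
qed

text \<open>Adjugate entries are signed minors, and evaluation at \<open>t\<close> commutes with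
  determinants. This supplies the polynomials for the adjugate condition.\<close>

lemma adj_mat_shift_polynomial:
  assumes ij: "i < n" "j < n"
  shows "adj_mat (t \<cdot>\<^sub>m 1\<^sub>m n - A) $$ (i, j) = poly (adj_mat (char_poly_matrix A) $$ (i, j)) t"
proof -
  let ?M = "t \<cdot>\<^sub>m 1\<^sub>m n - A" and ?P = "char_poly_matrix A"
  have P: "?P \<in> carrier_mat n n" using carrier by simp
  have "poly (det (mat_delete ?P j i)) t = det (mat_delete ?M j i)"
  proof (rule poly_det_cong[of _ "n - 1"])
    fix a b assume ab: "a < n - 1" "b < n - 1"
    then have "poly (?P $$ (a', b')) t = ?M $$ (a', b')" if "a' < n" "b' < n" for a' b'
      using that carrier by (auto simp: char_poly_matrix_def)
    then show "poly (mat_delete ?P j i $$ (a, b)) t = mat_delete ?M j i $$ (a, b)"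
      using ab carrier by (auto simp: mat_delete_def char_poly_matrix_def)
  qed (use mat_delete_carrier[OF P] mat_delete_carrier[OF shift_carrier] in auto)
  then show ?thesis
    using ij carrier carrier_matD[OF P] by (simp add: adj_mat_def cofactor_def)
qed

end

section \<open>Schur product conditions as equalities of entries\<close>

text \<open>Relates two positions that are both on the diagonal or both at edges: exactly where the
  Schur product conditions ask a matrix to be constant.\<close>

definition comparable :: "real mat \<Rightarrow> nat \<Rightarrow> nat \<Rightarrow> nat \<Rightarrow> nat \<Rightarrow> bool" where
  "comparable A i j k l \<longleftrightarrow>
     i < dim_row A \<and> j < dim_row A \<and> k < dim_row A \<and> l < dim_row A \<and>
     (i = j \<and> k = l \<or> A $$ (i, j) = 1 \<and> A $$ (k, l) = 1)"

lemma schur_scalar_eq_iff: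
  fixes A M :: "real mat"
  assumes A: "A \<in> carrier_mat n n" and M: "M \<in> carrier_mat n n"
    and binary: "\<forall>i<n. \<forall>j<n. A $$ (i, j) = 0 \<or> A $$ (i, j) = 1"
  shows "M \<circ>\<^sub>m 1\<^sub>m n = a \<cdot>\<^sub>m 1\<^sub>m n \<and> M \<circ>\<^sub>m A = b \<cdot>\<^sub>m A \<longleftrightarrow>
    (\<forall>i<n. M $$ (i, i) = a) \<and> (\<forall>i<n. \<forall>j<n. A $$ (i, j) = 1 \<longrightarrow> M $$ (i, j) = b)"
proof -
  have "M \<circ>\<^sub>m 1\<^sub>m n = a \<cdot>\<^sub>m 1\<^sub>m n \<longleftrightarrow> (\<forall>i<n. M $$ (i, i) = a)"
    using M by (auto simp: mat_eq_iff schur_prod_def)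
  moreover have "M \<circ>\<^sub>m A = b \<cdot>\<^sub>m A
      \<longleftrightarrow> (\<forall>i<n. \<forall>j<n. M $$ (i, j) * A $$ (i, j) = b * A $$ (i, j))"
    using M A by (auto simp: mat_eq_iff schur_prod_def)
  moreover have "M $$ (i, j) * A $$ (i, j) = b * A $$ (i, j) \<longleftrightarrow> (A $$ (i, j) = 1 \<longrightarrow> M $$ (i, j) = b)"
    if "i < n" "j < n" for i j
    using binary that by auto
  ultimately show ?thesis by auto
qed

text \<open>Eliminates the scalars: a family is constant iff its members agree pairwise, also when
  there are no vertices or no edges and any scalar will do.\<close>

lemma schur_scalar_iff_comparable:
  fixes A M :: "real mat"
  assumes A: "A \<in> carrier_mat n n" and M: "M \<in> carrier_mat n n"
    and binary: "\<forall>i<n. \<forall>j<n. A $$ (i, j) = 0 \<or> A $$ (i, j) = 1"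
  shows "(\<exists>a b. M \<circ>\<^sub>m 1\<^sub>m n = a \<cdot>\<^sub>m 1\<^sub>m n \<and> M \<circ>\<^sub>m A = b \<cdot>\<^sub>m A) \<longleftrightarrow>
    (\<forall>i j k l. comparable A i j k l \<longrightarrow> M $$ (i, j) = M $$ (k, l))"
proof -
  have diag: "(\<exists>a. \<forall>i<n. M $$ (i, i) = a) \<longleftrightarrow> (\<forall>i<n. \<forall>k<n. M $$ (i, i) = M $$ (k, k))"
    by metis
  have edges: "(\<exists>b. \<forall>i<n. \<forall>j<n. A $$ (i, j) = 1 \<longrightarrow> M $$ (i, j) = b) \<longleftrightarrow>
    (\<forall>i<n. \<forall>j<n. \<forall>k<n. \<forall>l<n. A $$ (i, j) = 1 \<longrightarrow> A $$ (k, l) = 1 \<longrightarrow> M $$ (i, j) = M $$ (k, l))"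
    by metis
  have both: "(\<forall>i j k l. comparable A i j k l \<longrightarrow> M $$ (i, j) = M $$ (k, l)) \<longleftrightarrow>
    (\<forall>i<n. \<forall>k<n. M $$ (i, i) = M $$ (k, k)) \<and>
    (\<forall>i<n. \<forall>j<n. \<forall>k<n. \<forall>l<n. A $$ (i, j) = 1 \<longrightarrow> A $$ (k, l) = 1 \<longrightarrow> M $$ (i, j) = M $$ (k, l))"
    unfolding comparable_def carrier_matD(1)[OF A] by blast
  show ?thesis
    unfolding schur_scalar_eq_iff[OF assms] both diag[symmetric] edges[symmetric] by blast
qed

section \<open>Equivalence of the seven conditions\<close>

theorem theorem2p1:
  fixes X :: "('a, 'b) pre_digraph" and n m :: nat and A :: "real mat"
    and \<theta> :: "nat \<Rightarrow> real" and E :: "nat \<Rightarrow> real mat"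
  assumes "graph X"
    and "n = card (verts X)"
    and "A = adjacency_matrix X"
    and "spectral_decomposition A m \<theta> E"
  shows
    "(one_walk_regular X \<longleftrightarrow>
        (\<forall>k\<ge>1. \<exists>a b :: real. (A ^\<^sub>m k) \<circ>\<^sub>m 1\<^sub>m n = a \<cdot>\<^sub>m 1\<^sub>m n \<and> (A ^\<^sub>m k) \<circ>\<^sub>m A = b \<cdot>\<^sub>m A)) \<and>
     (one_walk_regular X \<longleftrightarrow>
        (\<forall>k\<in>{1..n - 1}. \<exists>a b :: real. (A ^\<^sub>m k) \<circ>\<^sub>m 1\<^sub>m n = a \<cdot>\<^sub>m 1\<^sub>m n \<and> (A ^\<^sub>m k) \<circ>\<^sub>m A = b \<cdot>\<^sub>m A)) \<and>
     (one_walk_regular X \<longleftrightarrow>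
        (\<forall>r\<in>{1..m}. \<exists>\<alpha> \<beta> :: real. E r \<circ>\<^sub>m 1\<^sub>m n = \<alpha> \<cdot>\<^sub>m 1\<^sub>m n \<and> E r \<circ>\<^sub>m A = \<beta> \<cdot>\<^sub>m A)) \<and>
     (one_walk_regular X \<longleftrightarrow>
        (\<exists>a b :: real \<Rightarrow> real. \<forall>t B. mat_inverse (t \<cdot>\<^sub>m 1\<^sub>m n - A) = Some B \<longrightarrow>
           B \<circ>\<^sub>m 1\<^sub>m n = a t \<cdot>\<^sub>m 1\<^sub>m n \<and> B \<circ>\<^sub>m A = b t \<cdot>\<^sub>m A)) \<and>
     (one_walk_regular X \<longleftrightarrow>
        (\<exists>f g :: real poly. \<forall>t.
           adj_mat (t \<cdot>\<^sub>m 1\<^sub>m n - A) \<circ>\<^sub>m 1\<^sub>m n = poly f t \<cdot>\<^sub>m 1\<^sub>m n \<and>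
           adj_mat (t \<cdot>\<^sub>m 1\<^sub>m n - A) \<circ>\<^sub>m A = poly g t \<cdot>\<^sub>m A)) \<and>
     (one_walk_regular X \<longleftrightarrow>
        (\<forall>u\<in>verts X. \<forall>v\<in>verts X.
           graph_char_poly (delete_verts X {u}) = graph_char_poly (delete_verts X {v})) \<and>
        (\<forall>u v x y. u \<rightarrow>\<^bsub>X\<^esub> v \<longrightarrow> x \<rightarrow>\<^bsub>X\<^esub> y \<longrightarrow>
           graph_char_poly (delete_verts X {u, v}) = graph_char_poly (delete_verts X {x, y})))"
proof -
  interpret graph X by fact
  let ?vs = "vertex_list X"
  have carrier: "A \<in> carrier_mat n n" using assms adjacency_matrix_carrier by simp
  interpret symmetric_spectral A n m \<theta> E
    using assms carrier adjacency_matrix_symmetric by unfold_locales auto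
  have bij: "bij_betw ((!) ?vs) {..<n} (verts X)"
    by (intro bij_betw_nth) (auto simp: vertex_list length_vertex_list assms)
  have vs_mem: "?vs ! i \<in> verts X" if "i < n" for i
    using bij that by (auto simp: bij_betw_def)
  have vs_ex: "\<exists>i<n. u = ?vs ! i" if "u \<in> verts X" for u
    using bij that by (auto simp: bij_betw_def)
  have adj: "A $$ (i, j) = (if ?vs ! i \<rightarrow>\<^bsub>X\<^esub> ?vs ! j then 1 else 0)" if "i < n" "j < n" for i j
    using that assms by (simp add: adjacency_matrix_index)
  have binary: "\<forall>i<n. \<forall>j<n. A $$ (i, j) = 0 \<or> A $$ (i, j) = 1" using adj by simp
  have edge_neq: "i \<noteq> j" if "A $$ (i, j) = 1" "i < n" "j < n" for i j
    using that adj[of i j] by (auto simp: arcs_ends_conv dest: no_loops split: if_splits)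
  have comparableD: "i < n" "j < n" "k < n" "l < n" if "comparable A i j k l" for i j k l
    using that carrier by (auto simp: comparable_def)
  note schur = schur_scalar_iff_comparable[OF carrier _ binary]

  \<comment> \<open>\<open>?C\<close> is the hub of the equivalences: all idempotents agree at
    comparable positions.\<close>
  let ?C = "\<forall>i j k l. comparable A i j k l \<longrightarrow> (\<forall>r\<in>{1..m}. E r $$ (i, j) = E r $$ (k, l))"
  let ?b = "\<lambda>q. \<exists>a b :: real. (A ^\<^sub>m q) \<circ>\<^sub>m 1\<^sub>m n = a \<cdot>\<^sub>m 1\<^sub>m n \<and> (A ^\<^sub>m q) \<circ>\<^sub>m A = b \<cdot>\<^sub>m A"

  have b_iff: "?b q \<longleftrightarrow> (\<forall>i j k l. comparable A i j k l \<longrightarrow> (A ^\<^sub>m q) $$ (i, j) = (A ^\<^sub>m q) $$ (k, l))" for q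
    using carrier by (intro schur) auto
  \<comment> \<open>The Vandermonde system starts at exponent 0, the conditions on powers at 1. The
    gap is harmless: the identity matrix is 1 on the diagonal and, as there are no loops, 0 at every
    edge.\<close>
  have b_0: "?b 0"
    unfolding b_iff using carrier edge_neq by (auto simp: comparable_def)
  have C_b: "?b q" if ?C for q
    unfolding b_iff
  proof (intro allI impI)
    fix i j k l assume c: "comparable A i j k l"
    show "(A ^\<^sub>m q) $$ (i, j) = (A ^\<^sub>m q) $$ (k, l)"
      using pow_entries_eq_iff(2)[OF comparableD[OF c]] that c by blast
  qed
  have b_C: ?C if "\<And>q. q < n \<Longrightarrow> ?b q"
  proof (intro allI impI)
    fix i j k l assume c: "comparable A i j k l"
    then have "\<forall>q<n. (A ^\<^sub>m q) $$ (i, j) = (A ^\<^sub>m q) $$ (k, l)" using that b_iff by blast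
    then show "\<forall>r\<in>{1..m}. E r $$ (i, j) = E r $$ (k, l)"
      using pow_entries_eq_iff(1)[OF comparableD[OF c]] by blast
  qed
  have b: "(\<forall>q\<ge>1. ?b q) \<longleftrightarrow> ?C"
    using C_b b_C b_0 by (metis One_nat_def Suc_leI neq0_conv)
  have c: "(\<forall>q\<in>{1..n - 1}. ?b q) \<longleftrightarrow> ?C"
  proof
    assume *: "\<forall>q\<in>{1..n - 1}. ?b q"
    show ?C
    proof (rule b_C)
      fix q assume "q < n"
      then have "q = 0 \<or> q \<in> {1..n - 1}" by auto
      then show "?b q" using * b_0 by blast
    qed
  qed (use C_b in blast)

  have walks: "(A ^\<^sub>m q) $$ (i, j) = real (num_walks X q (?vs ! i) (?vs ! j))" if "i < n" "j < n" for q i j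
    using pow_adjacency_matrix_index that assms by simp
  have a: "one_walk_regular X \<longleftrightarrow> (\<forall>q\<ge>1. ?b q)"
  proof
    assume reg: "one_walk_regular X"
    show "\<forall>q\<ge>1. ?b q"
    proof (intro allI impI)
      fix q :: nat assume q: "q \<ge> 1"
      show "?b q" unfolding b_iff
      proof (intro allI impI)
        fix i j k l assume c: "comparable A i j k l"
        note lt = comparableD[OF c]
        from c consider "i = j" "k = l" | "?vs ! i \<rightarrow>\<^bsub>X\<^esub> ?vs ! j" "?vs ! k \<rightarrow>\<^bsub>X\<^esub> ?vs ! l"
          using lt adj by (auto simp: comparable_def split: if_splits)
        then have "num_walks X q (?vs ! i) (?vs ! j) = num_walks X q (?vs ! k) (?vs ! l)"
        proof cases
          case 1
          then show ?thesis
            using reg q vs_mem lt unfolding one_walk_regular_def walk_regular_def by blast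
        next
          case 2
          then show ?thesis using reg q unfolding one_walk_regular_def by blast
        qed
        then show "(A ^\<^sub>m q) $$ (i, j) = (A ^\<^sub>m q) $$ (k, l)" using lt by (simp add: walks)
      qed
    qed
  next
    assume b: "\<forall>q\<ge>1. ?b q"
    have eq: "num_walks X q (?vs ! i) (?vs ! j) = num_walks X q (?vs ! k) (?vs ! l)"
      if "q \<ge> 1" and c: "comparable A i j k l" for q i j k l
    proof -
      have "(A ^\<^sub>m q) $$ (i, j) = (A ^\<^sub>m q) $$ (k, l)" using b b_iff that by blast
      then show ?thesis using comparableD[OF c] by (simp add: walks)
    qed
    show "one_walk_regular X"
      unfolding one_walk_regular_def walk_regular_def
    proof (intro conjI allI impI ballI)
      fix q :: nat and u v assume "q \<ge> 1" "u \<in> verts X" "v \<in> verts X"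
      moreover from this obtain i k where "i < n" "u = ?vs ! i" "k < n" "v = ?vs ! k"
        using vs_ex by metis
      ultimately show "num_walks X q u u = num_walks X q v v"
        using eq[of q i i k k] carrier by (auto simp: comparable_def)
    next
      fix q :: nat and u v x y assume q: "q \<ge> 1" and e: "u \<rightarrow>\<^bsub>X\<^esub> v" "x \<rightarrow>\<^bsub>X\<^esub> y"
      then have "u \<in> verts X" "v \<in> verts X" "x \<in> verts X" "y \<in> verts X"
        using adj_in_verts by auto
      then obtain i j k l where "i < n" "u = ?vs ! i" "j < n" "v = ?vs ! j"
        "k < n" "x = ?vs ! k" "l < n" "y = ?vs ! l"
        using vs_ex by metis
      then show "num_walks X q u v = num_walks X q x y"
        using eq[of q i j k l] carrier q e adj by (auto simp: comparable_def)
    qed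
  qed

  have d: "(\<forall>r\<in>{1..m}. \<exists>\<alpha> \<beta> :: real. E r \<circ>\<^sub>m 1\<^sub>m n = \<alpha> \<cdot>\<^sub>m 1\<^sub>m n \<and> E r \<circ>\<^sub>m A = \<beta> \<cdot>\<^sub>m A) \<longleftrightarrow> ?C"
    using schur[OF projection_carrier] by blast

  \<comment> \<open>\<open>?R\<close> restates the hub for the resolvent; the conditions on the
    inverse and on the adjugate are compared with it.\<close>
  let ?R = "\<forall>t. t \<notin> \<theta> ` {1..m} \<longrightarrow>
    (\<forall>i j k l. comparable A i j k l \<longrightarrow> resolvent t $$ (i, j) = resolvent t $$ (k, l))"
  have R: "?R \<longleftrightarrow> ?C"
  proof -
    have "(\<forall>t. t \<notin> \<theta> ` {1..m} \<longrightarrow> resolvent t $$ (i, j) = resolvent t $$ (k, l))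
        \<longleftrightarrow> (\<forall>r\<in>{1..m}. E r $$ (i, j) = E r $$ (k, l))" if "comparable A i j k l" for i j k l
      by (rule resolvent_entries_eq_iff[OF comparableD[OF that]])
    then show ?thesis by blast
  qed
  have e: "(\<exists>a b :: real \<Rightarrow> real. \<forall>t B. mat_inverse (t \<cdot>\<^sub>m 1\<^sub>m n - A) = Some B \<longrightarrow>
      B \<circ>\<^sub>m 1\<^sub>m n = a t \<cdot>\<^sub>m 1\<^sub>m n \<and> B \<circ>\<^sub>m A = b t \<cdot>\<^sub>m A) \<longleftrightarrow> ?R"
  proof -
    have "?R \<longleftrightarrow> (\<forall>t. t \<notin> \<theta> ` {1..m} \<longrightarrow> (\<exists>a b :: real.
        resolvent t \<circ>\<^sub>m 1\<^sub>m n = a \<cdot>\<^sub>m 1\<^sub>m n \<and> resolvent t \<circ>\<^sub>m A = b \<cdot>\<^sub>m A))"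
      by (simp only: schur[OF resolvent_carrier])
    \<comment> \<open>The scalars found for each \<open>t\<close> are collected into functions of
      \<open>t\<close> by choice.\<close>
    also have "\<dots> \<longleftrightarrow> (\<exists>a b :: real \<Rightarrow> real. \<forall>t. t \<notin> \<theta> ` {1..m} \<longrightarrow>
        resolvent t \<circ>\<^sub>m 1\<^sub>m n = a t \<cdot>\<^sub>m 1\<^sub>m n \<and> resolvent t \<circ>\<^sub>m A = b t \<cdot>\<^sub>m A)"
      by metis
    also have "\<dots> \<longleftrightarrow> (\<exists>a b :: real \<Rightarrow> real. \<forall>t B. mat_inverse (t \<cdot>\<^sub>m 1\<^sub>m n - A) = Some B \<longrightarrow>
        B \<circ>\<^sub>m 1\<^sub>m n = a t \<cdot>\<^sub>m 1\<^sub>m n \<and> B \<circ>\<^sub>m A = b t \<cdot>\<^sub>m A)"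
      by (intro ex_cong1) (simp add: mat_inverse_shift)
    finally show ?thesis by (rule sym)
  qed

  let ?adj = "\<lambda>t. adj_mat (t \<cdot>\<^sub>m 1\<^sub>m n - A)"
  have f: "(\<exists>f g :: real poly. \<forall>t.
      ?adj t \<circ>\<^sub>m 1\<^sub>m n = poly f t \<cdot>\<^sub>m 1\<^sub>m n \<and> ?adj t \<circ>\<^sub>m A = poly g t \<cdot>\<^sub>m A) \<longleftrightarrow> ?R"
  proof
    assume "\<exists>f g :: real poly. \<forall>t.
      ?adj t \<circ>\<^sub>m 1\<^sub>m n = poly f t \<cdot>\<^sub>m 1\<^sub>m n \<and> ?adj t \<circ>\<^sub>m A = poly g t \<cdot>\<^sub>m A"
    then have adj_eq: "?adj t $$ (i, j) = ?adj t $$ (k, l)" if "comparable A i j k l" for t i j k l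
      using schur[OF adj_mat(1)[OF shift_carrier]] that by blast
    show ?R
    proof (intro allI impI)
      fix t i j k l assume t: "t \<notin> \<theta> ` {1..m}" and c: "comparable A i j k l"
      have "det (t \<cdot>\<^sub>m 1\<^sub>m n - A) \<noteq> 0" using t det_shift_eq_0_iff by blast
      then show "resolvent t $$ (i, j) = resolvent t $$ (k, l)"
        using adj_eq[OF c, of t] comparableD[OF c] by (simp add: adj_mat_shift[OF t])
    qed
  next
    assume R: ?R
    \<comment> \<open>Entries of the adjugate over the polynomial ring serve as \<open>f\<close> and
      \<open>g\<close>. Their equality is checked off the spectrum only, but as polynomials they
      then agree at the eigenvalues too.\<close>
    define P where "P i j = adj_mat (char_poly_matrix A) $$ (i, j)" for i j
    have P_eq: "P i j = P k l" if c: "comparable A i j k l" for i j k l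
    proof (rule poly_eq_if_eq_off_finite[of "\<theta> ` {1..m}"])
      fix t assume t: "t \<notin> \<theta> ` {1..m}"
      have "?adj t $$ (i, j) = ?adj t $$ (k, l)"
        using R t c comparableD[OF c] by (simp add: adj_mat_shift[OF t])
      then show "poly (P i j) t = poly (P k l) t"
        using comparableD[OF c] by (simp add: adj_mat_shift_polynomial P_def)
    qed simp
    have "\<exists>f. \<forall>i<n. P i i = f"
      using P_eq carrier unfolding comparable_def by (metis carrier_matD(1))
    moreover have "\<exists>g. \<forall>i<n. \<forall>j<n. A $$ (i, j) = 1 \<longrightarrow> P i j = g"
      using P_eq carrier unfolding comparable_def by (metis carrier_matD(1))
    ultimately obtain f g where "\<forall>i<n. P i i = f"
      "\<forall>i<n. \<forall>j<n. A $$ (i, j) = 1 \<longrightarrow> P i j = g" by blast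
    then have "\<forall>t. ?adj t \<circ>\<^sub>m 1\<^sub>m n = poly f t \<cdot>\<^sub>m 1\<^sub>m n \<and> ?adj t \<circ>\<^sub>m A = poly g t \<cdot>\<^sub>m A"
      unfolding schur_scalar_eq_iff[OF carrier adj_mat(1)[OF shift_carrier] binary]
      by (simp add: adj_mat_shift_polynomial P_def)
    then show "\<exists>f g :: real poly. \<forall>t.
      ?adj t \<circ>\<^sub>m 1\<^sub>m n = poly f t \<cdot>\<^sub>m 1\<^sub>m n \<and> ?adj t \<circ>\<^sub>m A = poly g t \<cdot>\<^sub>m A" by blast
  qed

  let ?D = "\<lambda>t. det (t \<cdot>\<^sub>m 1\<^sub>m n - A)"
  let ?phi = "\<lambda>R. graph_char_poly (delete_verts X R)"
  have D: "?D t \<noteq> 0" if "t \<notin> \<theta> ` {1..m}" for t using that det_shift_eq_0_iff by blast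
  have delete: "poly (?phi ((!) ?vs ` set is)) t
      = ?D t * det (mat (length is) (length is) (\<lambda>(i, j). resolvent t $$ (is ! i, is ! j)))"
    if "distinct is" "set is \<subseteq> {..<n}" "t \<notin> \<theta> ` {1..m}" for "is" t
    using that shift_mult_resolvent resolvent_carrier
    by (intro poly_char_poly_delete_verts) (simp_all add: assms)
  have phi1: "poly (?phi {?vs ! i}) t = ?D t * resolvent t $$ (i, i)"
    if "i < n" "t \<notin> \<theta> ` {1..m}" for i t
    using delete[of "[i]" t] that by (simp add: det_single)
  have phi2: "poly (?phi {?vs ! i, ?vs ! j}) t
      = ?D t * (resolvent t $$ (i, i) * resolvent t $$ (j, j) - (resolvent t $$ (i, j))\<^sup>2)"
    if "i < n" "j < n" "i \<noteq> j" "t \<notin> \<theta> ` {1..m}" for i j t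
  proof -
    \<comment> \<open>Symmetry turns the off-diagonal product of the two-by-two minor into a
      square.\<close>
    have "resolvent t $$ (j, i) = resolvent t $$ (i, j)"
      using resolvent_symmetric[OF that(4)] that resolvent_dim by (metis index_transpose_mat(1))
    then show ?thesis
      using delete[of "[i, j]" t] that
      by (simp add: det_two_by_two numeral_2_eq_2[symmetric] power2_eq_square)
  qed
  have g: "(\<forall>u\<in>verts X. \<forall>v\<in>verts X. ?phi {u} = ?phi {v}) \<and>
      (\<forall>u v x y. u \<rightarrow>\<^bsub>X\<^esub> v \<longrightarrow> x \<rightarrow>\<^bsub>X\<^esub> y \<longrightarrow> ?phi {u, v} = ?phi {x, y}) \<longleftrightarrow> ?C" (is "?g1 \<and> ?g2 \<longleftrightarrow> _")
  proof
    assume g: "?g1 \<and> ?g2"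
    have diag: "resolvent t $$ (i, i) = resolvent t $$ (k, k)"
      if "i < n" "k < n" "t \<notin> \<theta> ` {1..m}" for i k t
    proof -
      have "?phi {?vs ! i} = ?phi {?vs ! k}" using g vs_mem that by blast
      then have "?D t * resolvent t $$ (i, i) = ?D t * resolvent t $$ (k, k)"
        using phi1 that by metis
      then show ?thesis using D[OF that(3)] by simp
    qed
    show ?C
    proof (intro allI impI)
      fix i j k l assume c: "comparable A i j k l"
      note lt = comparableD[OF c]
      from c consider "i = j" "k = l" | "A $$ (i, j) = 1" "A $$ (k, l) = 1"
        by (auto simp: comparable_def)
      then show "\<forall>r\<in>{1..m}. E r $$ (i, j) = E r $$ (k, l)"
      proof cases
        case 1
        then show ?thesis using resolvent_entries_eq_iff[OF lt] diag[OF lt(1,3)] by simp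
      next
        case 2
        then have neq: "i \<noteq> j" "k \<noteq> l" using edge_neq lt by auto
        have "?vs ! i \<rightarrow>\<^bsub>X\<^esub> ?vs ! j" "?vs ! k \<rightarrow>\<^bsub>X\<^esub> ?vs ! l"
          using 2 adj lt by (auto split: if_splits)
        then have phi: "?phi {?vs ! i, ?vs ! j} = ?phi {?vs ! k, ?vs ! l}" using g by blast
        \<comment> \<open>Deleting single vertices has made the diagonal entries equal, so
          cancelling the determinant leaves only the squares at the edges. The entries of
          \<open>A\<close>, both 1 there, then exclude the opposite sign.\<close>
        have "(resolvent t $$ (i, j))\<^sup>2 = (resolvent t $$ (k, l))\<^sup>2" if t: "t \<notin> \<theta> ` {1..m}" for t
        proof -
          have "?D t * (resolvent t $$ (i, i) * resolvent t $$ (j, j) - (resolvent t $$ (i, j))\<^sup>2)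
              = ?D t * (resolvent t $$ (k, k) * resolvent t $$ (l, l) - (resolvent t $$ (k, l))\<^sup>2)"
            using phi phi2 lt neq t by metis
          moreover have "resolvent t $$ (i, i) = resolvent t $$ (k, k)"
            "resolvent t $$ (j, j) = resolvent t $$ (l, l)"
            using diag[OF lt(1,3) t] diag[OF lt(2,4) t] by simp_all
          ultimately show ?thesis using D[OF t] by simp
        qed
        then show ?thesis using resolvent_squares_eq_imp[OF lt] 2 by simp
      qed
    qed
  next
    assume ?C
    then have ?R using R by (rule iffD2[rotated])
    then have R: "resolvent t $$ (i, j) = resolvent t $$ (k, l)"
      if "comparable A i j k l" "t \<notin> \<theta> ` {1..m}" for t i j k l
      using that by blast
    have diag: "resolvent t $$ (i, i) = resolvent t $$ (k, k)"
      if "i < n" "k < n" "t \<notin> \<theta> ` {1..m}" for i k t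
      using that carrier by (intro R) (auto simp: comparable_def)
    show "?g1 \<and> ?g2"
    proof (intro conjI ballI allI impI)
      fix u v assume "u \<in> verts X" "v \<in> verts X"
      then obtain i k where ik: "i < n" "u = ?vs ! i" "k < n" "v = ?vs ! k" using vs_ex by metis
      show "?phi {u} = ?phi {v}"
      \<comment> \<open>The minor formulas express the characteristic polynomial through the
        resolvent only off the spectrum; agreement there is enough for equality of
        polynomials.\<close>
      proof (rule poly_eq_if_eq_off_finite[of "\<theta> ` {1..m}"])
        fix t assume "t \<notin> \<theta> ` {1..m}"
        then show "poly (?phi {u}) t = poly (?phi {v}) t"
          using phi1 diag[OF ik(1,3)] ik by simp
      qed simp
    next
      fix u v x y assume e: "u \<rightarrow>\<^bsub>X\<^esub> v" "x \<rightarrow>\<^bsub>X\<^esub> y"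
      then have "u \<in> verts X" "v \<in> verts X" "x \<in> verts X" "y \<in> verts X"
        using adj_in_verts by auto
      then obtain i j k l where lt: "i < n" "j < n" "k < n" "l < n"
        and uv: "u = ?vs ! i" "v = ?vs ! j" "x = ?vs ! k" "y = ?vs ! l"
        using vs_ex by metis
      have A1: "A $$ (i, j) = 1" "A $$ (k, l) = 1" using e uv adj lt by auto
      then have neq: "i \<noteq> j" "k \<noteq> l" using edge_neq lt by auto
      have c: "comparable A i j k l" using A1 lt carrier by (auto simp: comparable_def)
      show "?phi {u, v} = ?phi {x, y}"
      proof (rule poly_eq_if_eq_off_finite[of "\<theta> ` {1..m}"])
        fix t assume t: "t \<notin> \<theta> ` {1..m}"
        then show "poly (?phi {u, v}) t = poly (?phi {x, y}) t"
          using diag[OF lt(1,3) t] diag[OF lt(2,4) t] R[OF c t]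
          by (simp add: uv phi2 lt neq)
      qed simp
    qed
  qed
  show ?thesis
    by (simp only: a b c d e f g R simp_thms)
qed

end
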